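(* Let $K$ be a finite simplicial complex with totally ordered vertices $v_1,\dots,v_n$. The pairs of the lexicographic gradient $V_L$ on $K$ are exactly the apparent pairs of the lexicographic filtration of $K$.
   Context: Simplices are nonempty finite sets of vertices, $\dim\sigma=|\sigma|-1$, and a simplicial complex is a collection of simplices closed under taking nonempty subsets. $\sigma$ is a facet of $\tau$ (and $\tau$ a cofacet of $\sigma$) if $\sigma\subset\tau$ and $\dim\tau=\dim\sigma+1$; facets and cofacets are taken among the simplices of $K$. Lexicographic gradient $V_L$: for a simplex $\sigma=\{v_{i_d},\dots,v_{i_1}\}\in K$ with $i_d>\dots>i_1$ ($d\ge 1$), if there is an index $i<i_1$ with $\sigma\cup\{v_i\}\in K$, then, taking $i_0$ to be the minimal such index, $V_L$ contains the pair $(\sigma,\tau)$ with $\tau=\sigma\cup\{v_{i_0}\}$. $V_L$ consists of all pairs obtained in this way. Lexicographic filtration of $K$: the simplices are totally ordered by dimension, and simplices of equal dimension are ordered lexicographically, where a simplex is identified with the tuple of its vertex indices listed in decreasing order. A simplex is older than another if it comes earlier in this order, and younger if it comes later. Apparent pair (of a total order on the simplices extending the face relation): a pair $(\sigma,\tau)$ of simplices of $K$ such that $\sigma$ is the youngest facet of $\tau$ and $\tau$ is the oldest cofacet of $\sigma$. *)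

theory Defs
  imports Main
begin

definition simplicial_complex :: "'a set set \<Rightarrow> bool" where
  "simplicial_complex K \<longleftrightarrow>
     (\<forall>\<sigma>\<in>K. finite \<sigma> \<and> \<sigma> \<noteq> {}) \<and> (\<forall>\<sigma>\<in>K. \<forall>\<rho>. \<rho> \<noteq> {} \<and> \<rho> \<subseteq> \<sigma> \<longrightarrow> \<rho> \<in> K)"

definition simplex_dim :: "'a set \<Rightarrow> int" where
  "simplex_dim \<sigma> = int (card \<sigma>) - 1"

definition facet :: "'a set set \<Rightarrow> 'a set \<Rightarrow> 'a set \<Rightarrow> bool" where
  "facet K \<sigma> \<tau> \<longleftrightarrow> \<sigma> \<in> K \<and> \<tau> \<in> K \<and> \<sigma> \<subset> \<tau> \<and> simplex_dim \<tau> = simplex_dim \<sigma> + 1"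

definition vertex_indices :: "(nat \<Rightarrow> 'a) \<Rightarrow> nat \<Rightarrow> 'a set \<Rightarrow> nat set" where
  "vertex_indices v n \<sigma> = {i \<in> {1..n}. v i \<in> \<sigma>}"

definition index_tuple :: "(nat \<Rightarrow> 'a) \<Rightarrow> nat \<Rightarrow> 'a set \<Rightarrow> nat list" where
  "index_tuple v n \<sigma> = rev (sorted_list_of_set (vertex_indices v n \<sigma>))"

definition lower_cofacet_indices ::
    "(nat \<Rightarrow> 'a) \<Rightarrow> nat \<Rightarrow> 'a set set \<Rightarrow> 'a set \<Rightarrow> nat set" where
  "lower_cofacet_indices v n K \<sigma> =
     {i \<in> {1..n}. i < Min (vertex_indices v n \<sigma>) \<and> \<sigma> \<union> {v i} \<in> K}"

definition lex_gradient :: "(nat \<Rightarrow> 'a) \<Rightarrow> nat \<Rightarrow> 'a set set \<Rightarrow> ('a set \<times> 'a set) set" where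
  "lex_gradient v n K =
     {(\<sigma>, \<sigma> \<union> {v (Min (lower_cofacet_indices v n K \<sigma>))}) | \<sigma>.
        \<sigma> \<in> K \<and> lower_cofacet_indices v n K \<sigma> \<noteq> {}}"

text \<open>A filtration is represented by the strict order in which the simplices appear:
  \<open>(\<rho>, \<sigma>) \<in> r\<close> means that \<open>\<rho>\<close> is older than \<open>\<sigma>\<close>.\<close>

definition lex_filtration :: "(nat \<Rightarrow> 'a) \<Rightarrow> nat \<Rightarrow> 'a set set \<Rightarrow> 'a set rel" where
  "lex_filtration v n K =
     {(\<rho>, \<sigma>) \<in> K \<times> K. simplex_dim \<rho> < simplex_dim \<sigma> \<or>
        simplex_dim \<rho> = simplex_dim \<sigma> \<and> (index_tuple v n \<rho>, index_tuple v n \<sigma>) \<in> lex less_than}"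

definition youngest_facet :: "'a set set \<Rightarrow> 'a set rel \<Rightarrow> 'a set \<Rightarrow> 'a set \<Rightarrow> bool" where
  "youngest_facet K r \<sigma> \<tau> \<longleftrightarrow> facet K \<sigma> \<tau> \<and> (\<forall>\<rho>. facet K \<rho> \<tau> \<and> \<rho> \<noteq> \<sigma> \<longrightarrow> (\<rho>, \<sigma>) \<in> r)"

definition oldest_cofacet :: "'a set set \<Rightarrow> 'a set rel \<Rightarrow> 'a set \<Rightarrow> 'a set \<Rightarrow> bool" where
  "oldest_cofacet K r \<tau> \<sigma> \<longleftrightarrow> facet K \<sigma> \<tau> \<and> (\<forall>\<rho>. facet K \<sigma> \<rho> \<and> \<rho> \<noteq> \<tau> \<longrightarrow> (\<tau>, \<rho>) \<in> r)"

definition apparent_pairs :: "'a set set \<Rightarrow> 'a set rel \<Rightarrow> ('a set \<times> 'a set) set" where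
  "apparent_pairs K r = {(\<sigma>, \<tau>). youngest_facet K r \<sigma> \<tau> \<and> oldest_cofacet K r \<tau> \<sigma>}"

lemma strict_linear_order_lex_filtration:
  assumes v: "bij_betw v {1..n} (\<Union>K)"
  shows "strict_linear_order_on K (lex_filtration v n K)"
proof -
  have inj: "\<rho> = \<sigma>" if "\<rho> \<in> K" "\<sigma> \<in> K" "index_tuple v n \<rho> = index_tuple v n \<sigma>" for \<rho> \<sigma>
  proof -
    have "vertex_indices v n \<rho> = vertex_indices v n \<sigma>"
      using arg_cong[OF that(3), of set] by (simp add: index_tuple_def vertex_indices_def)
    moreover have "v ` vertex_indices v n \<tau> = \<tau>" if "\<tau> \<in> K" for \<tau>
    proof -
      have "\<tau> \<subseteq> v ` {1..n}" using that v by (auto simp: bij_betw_def)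
      then show ?thesis by (auto simp: vertex_indices_def)
    qed
    ultimately show ?thesis using that(1,2) by metis
  qed
  have len: "length (index_tuple v n \<sigma>) = card \<sigma>" if "\<sigma> \<in> K" for \<sigma>
  proof -
    have "\<sigma> \<subseteq> v ` {1..n}" using that v by (auto simp: bij_betw_def)
    then have "v ` vertex_indices v n \<sigma> = \<sigma>" by (auto simp: vertex_indices_def)
    moreover have "inj_on v (vertex_indices v n \<sigma>)"
      using v by (auto simp: bij_betw_def vertex_indices_def intro: inj_on_subset[of v "{1..n}"])
    ultimately have "card (vertex_indices v n \<sigma>) = card \<sigma>" by (metis card_image)
    then show ?thesis by (simp add: index_tuple_def)
  qed
  have eq: "lex_filtration v n K =
      {(\<rho>, \<sigma>) \<in> K \<times> K. (index_tuple v n \<rho>, index_tuple v n \<sigma>) \<in> lenlex less_than}"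
    by (auto simp: lex_filtration_def lenlex_def simplex_dim_def len)
  have "trans (lex_filtration v n K)"
    unfolding eq using lenlex_transI[OF trans_less_than] by (blast intro: transI dest: transD)
  moreover have "irrefl (lex_filtration v n K)"
    unfolding eq using lenlex_irreflexive[of less_than] by (auto simp: irrefl_def)
  moreover have "total_on K (lex_filtration v n K)"
  proof (unfold total_on_def, intro ballI impI)
    fix \<rho> \<sigma> assume *: "\<rho> \<in> K" "\<sigma> \<in> K" "\<rho> \<noteq> \<sigma>"
    then have "index_tuple v n \<rho> \<noteq> index_tuple v n \<sigma>" using inj by blast
    then have "(index_tuple v n \<rho>, index_tuple v n \<sigma>) \<in> lenlex less_than \<or>
        (index_tuple v n \<sigma>, index_tuple v n \<rho>) \<in> lenlex less_than"
      by (intro total_lenlex[OF total_less_than, unfolded total_on_def, rule_format]) simp_all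
    then show "(\<rho>, \<sigma>) \<in> lex_filtration v n K \<or> (\<sigma>, \<rho>) \<in> lex_filtration v n K"
      using * by (simp add: eq)
  qed
  ultimately show ?thesis by (simp add: strict_linear_order_on_def)
qed

lemma lex_filtration_extends_face:
  assumes "simplicial_complex K" "\<rho> \<in> K" "\<sigma> \<in> K" "\<rho> \<subset> \<sigma>"
  shows "(\<rho>, \<sigma>) \<in> lex_filtration v n K"
proof -
  have "finite \<sigma>" using assms(1,3) by (simp add: simplicial_complex_def)
  then have "card \<rho> < card \<sigma>" using assms(4) by (rule psubset_card_mono)
  then show ?thesis using assms(2,3) by (simp add: lex_filtration_def simplex_dim_def)
qed

end

(* Exchanging one vertex for another of larger index makes a simplex lexicographically larger. Hence
   the youngest facet of a simplex omits its vertex of least index, and the oldest cofacet of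
   a simplex adds the vertex of least index that spans a simplex of K with it. Requiring both for
   (\<sigma>, \<sigma> \<union> {v i}) means that i is the least admissible index and lies below all indices
   of \<sigma>, which is the condition that defines the lexicographic gradient. *)
theory Submission
  imports Defs
begin

text \<open>This lets a decreasing index tuple grow at its head, the position that
  \<open>lex\<close> compares first.\<close>

lemma rev_sorted_list_of_set_insert_max:
  fixes A :: "'a::linorder set"
  assumes "finite A" and "\<forall>x\<in>A. x < a"
  shows "rev (sorted_list_of_set (insert a A)) = a # rev (sorted_list_of_set A)"
proof -
  have "a \<notin> A" using assms(2) by blast
  then have "sorted_list_of_set (insert a A) = insort a (sorted_list_of_set A)"
    using assms(1) by simp
  also have "\<dots> = sorted_list_of_set A @ [a]"
    using assms by (intro sorted_insort_is_snoc) (auto intro: less_imp_le)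
  finally show ?thesis by simp
qed

text \<open>Induction adds a new maximum \<open>c\<close> to \<open>S\<close>. If
  \<open>b < c\<close>, both lists begin with \<open>c\<close> and the induction hypothesis compares
  the tails. Otherwise \<open>b\<close> exceeds every element of
  \<open>insert a (insert c S)\<close>, so it heads the second list and already the first entries
  decide.\<close>

lemma rev_sorted_list_of_set_insert_lex:
  fixes S :: "nat set"
  assumes "finite S" and "a < b" and "a \<notin> S" and "b \<notin> S"
  shows "(rev (sorted_list_of_set (insert a S)), rev (sorted_list_of_set (insert b S))) \<in> lex less_than"
  using assms
proof (induction rule: finite_linorder_max_induct)
  case empty
  then show ?case by simp
next
  case (insert c S)
  \<comment> \<open>\<open>lex\<close> relates only lists of equal length, so a smaller head alone
    does not suffice.\<close>
  have len: "length (sorted_list_of_set (insert a (insert c S)))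
      = length (sorted_list_of_set (insert b (insert c S)))"
    using insert by simp
  show ?case
  proof (cases "b < c")
    case True
    have "(rev (sorted_list_of_set (insert c (insert a S))), rev (sorted_list_of_set (insert c (insert b S))))
        \<in> lex less_than"
      using insert True by (simp add: rev_sorted_list_of_set_insert_max del: sorted_list_of_set_insert_remove)
    then show ?thesis by (simp only: insert_commute)
  next
    case False
    then have "c < b" using insert.prems by simp
    then have below: "\<forall>x\<in>insert c S. x < b" using insert.hyps(2) by auto
    have b: "rev (sorted_list_of_set (insert b (insert c S))) = b # rev (sorted_list_of_set (insert c S))"
      using below insert.hyps(1) by (intro rev_sorted_list_of_set_insert_max) auto
    obtain x xs where x: "rev (sorted_list_of_set (insert a (insert c S))) = x # xs"
      using insert.hyps(1) by (cases "rev (sorted_list_of_set (insert a (insert c S)))") auto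
    \<comment> \<open>Whether \<open>x\<close> is \<open>a\<close> or \<open>c\<close> does not
      matter: as a member of the first set it is below \<open>b\<close>.\<close>
    have "x \<in> set (rev (sorted_list_of_set (insert a (insert c S))))" unfolding x by simp
    then have "x \<in> insert a (insert c S)"
      using insert.hyps(1) by (simp only: set_rev set_sorted_list_of_set finite_insert)
    then have "x < b" using below insert.prems(1) by auto
    moreover have "length (x # xs) = length (b # rev (sorted_list_of_set (insert c S)))"
      using len unfolding x[symmetric] b[symmetric] by simp
    ultimately show ?thesis unfolding x b by simp
  qed
qed

lemma vertex_indices_insert:
  assumes "bij_betw v {1..n} V" and "i \<in> {1..n}"
  shows "vertex_indices v n (insert (v i) \<sigma>) = insert i (vertex_indices v n \<sigma>)"
  using assms by (auto simp: vertex_indices_def bij_betw_def dest: inj_onD)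

lemma finite_vertex_indices [simp]: "finite (vertex_indices v n \<sigma>)"
  by (simp add: vertex_indices_def)

lemma lex_filtration_insert_less:
  assumes "bij_betw v {1..n} V" and "finite \<sigma>"
    and "i \<in> {1..n}" "v i \<notin> \<sigma>" "insert (v i) \<sigma> \<in> K"
    and "j \<in> {1..n}" "v j \<notin> \<sigma>" "insert (v j) \<sigma> \<in> K"
    and "i < j"
  shows "(insert (v i) \<sigma>, insert (v j) \<sigma>) \<in> lex_filtration v n K"
proof -
  have "(index_tuple v n (insert (v i) \<sigma>), index_tuple v n (insert (v j) \<sigma>)) \<in> lex less_than"
    unfolding index_tuple_def vertex_indices_insert[OF assms(1,3)] vertex_indices_insert[OF assms(1,6)]
    using assms by (intro rev_sorted_list_of_set_insert_lex) (auto simp: vertex_indices_def)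
  then show ?thesis using assms by (simp add: lex_filtration_def simplex_dim_def)
qed

text \<open>The converse comes from strictness of the order: \<open>i = j\<close> contradicts
  irreflexivity, and \<open>j < i\<close> would give the opposite relation as well. Here \<sigma> is
  any finite set, because facets are compared over \<open>\<sigma> - {v j}\<close>, which is empty
  when \<sigma> is a vertex.\<close>

lemma lex_filtration_insert_iff:
  assumes v: "bij_betw v {1..n} (\<Union>K)" and fin: "finite \<sigma>"
    and i: "i \<in> {1..n}" "v i \<notin> \<sigma>" "insert (v i) \<sigma> \<in> K"
    and j: "j \<in> {1..n}" "v j \<notin> \<sigma>" "insert (v j) \<sigma> \<in> K"
  shows "(insert (v i) \<sigma>, insert (v j) \<sigma>) \<in> lex_filtration v n K \<longleftrightarrow> i < j"
proof
  assume r: "(insert (v i) \<sigma>, insert (v j) \<sigma>) \<in> lex_filtration v n K"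
  have lin: "trans (lex_filtration v n K)" "irrefl (lex_filtration v n K)"
    using strict_linear_order_lex_filtration[OF v] by (auto simp: strict_linear_order_on_def)
  show "i < j"
  proof (rule ccontr)
    assume "\<not> i < j"
    then consider "i = j" | "j < i" by linarith
    then show False
    proof cases
      case 1
      then show ?thesis using r lin(2) by (simp add: irrefl_def)
    next
      case 2
      then show ?thesis
        using lex_filtration_insert_less[OF v fin j i] r lin by (meson irrefl_def transD)
    qed
  qed
qed (rule lex_filtration_insert_less[OF v fin i j])

lemma simplex_finite: "simplicial_complex K \<Longrightarrow> \<sigma> \<in> K \<Longrightarrow> finite \<sigma>"
  and simplex_nonempty: "simplicial_complex K \<Longrightarrow> \<sigma> \<in> K \<Longrightarrow> \<sigma> \<noteq> {}"
  and simplex_face: "simplicial_complex K \<Longrightarrow> \<sigma> \<in> K \<Longrightarrow> \<rho> \<subseteq> \<sigma> \<Longrightarrow> \<rho> \<noteq> {} \<Longrightarrow> \<rho> \<in> K"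
  unfolding simplicial_complex_def by blast+

text \<open>Codimension one leaves exactly one vertex of \<tau> outside \<sigma>, and it has an
  index because \<tau> lies in \<open>K\<close>. Quantifiers over facets and cofacets thereby become
  quantifiers over indices.\<close>

lemma facet_iff_insert:
  assumes "simplicial_complex K" and "bij_betw v {1..n} (\<Union>K)"
  shows "facet K \<sigma> \<tau> \<longleftrightarrow>
    \<sigma> \<in> K \<and> \<tau> \<in> K \<and> (\<exists>i\<in>{1..n}. v i \<notin> \<sigma> \<and> \<tau> = insert (v i) \<sigma>)"
proof
  assume f: "facet K \<sigma> \<tau>"
  then have K: "\<sigma> \<in> K" "\<tau> \<in> K" and sub: "\<sigma> \<subset> \<tau>" and card: "card \<tau> = card \<sigma> + 1"
    by (auto simp: facet_def simplex_dim_def)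
  have fin: "finite \<tau>" by (rule simplex_finite[OF assms(1) K(2)])
  obtain x where x: "x \<in> \<tau>" "x \<notin> \<sigma>" using sub by blast
  have "finite \<sigma>" using fin sub by (meson finite_subset psubset_imp_subset)
  then have "insert x \<sigma> = \<tau>"
    using x fin sub card by (intro card_subset_eq) auto
  moreover obtain i where "i \<in> {1..n}" "x = v i"
    using x(1) K(2) assms(2) by (fastforce simp: bij_betw_def)
  ultimately show "\<sigma> \<in> K \<and> \<tau> \<in> K \<and> (\<exists>i\<in>{1..n}. v i \<notin> \<sigma> \<and> \<tau> = insert (v i) \<sigma>)"
    using K x(2) by blast
next
  assume "\<sigma> \<in> K \<and> \<tau> \<in> K \<and> (\<exists>i\<in>{1..n}. v i \<notin> \<sigma> \<and> \<tau> = insert (v i) \<sigma>)"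
  then show "facet K \<sigma> \<tau>"
    using simplex_finite[OF assms(1)] by (auto simp: facet_def simplex_dim_def)
qed

text \<open>Any two cofacets of \<sigma> extend the same set by one vertex each, so their ages
  compare as the indices of the added vertices.\<close>

lemma oldest_cofacet_insert_iff:
  assumes K: "simplicial_complex K" and v: "bij_betw v {1..n} (\<Union>K)"
    and \<sigma>: "\<sigma> \<in> K" and i: "i \<in> {1..n}" "v i \<notin> \<sigma>" "insert (v i) \<sigma> \<in> K"
  shows "oldest_cofacet K (lex_filtration v n K) (insert (v i) \<sigma>) \<sigma> \<longleftrightarrow>
    (\<forall>j\<in>{1..n}. v j \<notin> \<sigma> \<and> insert (v j) \<sigma> \<in> K \<longrightarrow> i \<le> j)"
proof -
  have fin: "finite \<sigma>" by (rule simplex_finite[OF K \<sigma>])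
  \<comment> \<open>Injectivity of \<open>v\<close> turns the condition that the cofacets differ
    into \<open>j \<noteq> i\<close>.\<close>
  have eq: "insert (v j) \<sigma> = insert (v i) \<sigma> \<longleftrightarrow> j = i" if "j \<in> {1..n}" "v j \<notin> \<sigma>" for j
    using that i v by (auto simp: bij_betw_def dest: inj_onD)
  have "oldest_cofacet K (lex_filtration v n K) (insert (v i) \<sigma>) \<sigma> \<longleftrightarrow>
      (\<forall>j\<in>{1..n}. v j \<notin> \<sigma> \<and> insert (v j) \<sigma> \<in> K \<and> j \<noteq> i \<longrightarrow>
        (insert (v i) \<sigma>, insert (v j) \<sigma>) \<in> lex_filtration v n K)"
    unfolding oldest_cofacet_def facet_iff_insert[OF K v] using \<sigma> i eq by blast
  also have "\<dots> \<longleftrightarrow> (\<forall>j\<in>{1..n}. v j \<notin> \<sigma> \<and> insert (v j) \<sigma> \<in> K \<and> j \<noteq> i \<longrightarrow> i < j)"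
    using lex_filtration_insert_iff[OF v fin i] by blast
  also have "\<dots> \<longleftrightarrow> (\<forall>j\<in>{1..n}. v j \<notin> \<sigma> \<and> insert (v j) \<sigma> \<in> K \<longrightarrow> i \<le> j)"
    by (metis le_eq_less_or_eq)
  finally show ?thesis .
qed

text \<open>Each facet other than \<sigma> arises by exchanging some \<open>v j\<close> in \<sigma>
  for \<open>v i\<close>. It shares \<open>\<sigma> - {v j}\<close> with \<sigma>, so it is older
  than \<sigma> exactly when \<open>i < j\<close>.\<close>

lemma youngest_facet_insert_iff:
  assumes K: "simplicial_complex K" and v: "bij_betw v {1..n} (\<Union>K)"
    and \<sigma>: "\<sigma> \<in> K" and i: "i \<in> {1..n}" "v i \<notin> \<sigma>" "insert (v i) \<sigma> \<in> K"
  shows "youngest_facet K (lex_filtration v n K) \<sigma> (insert (v i) \<sigma>) \<longleftrightarrow>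
    (\<forall>j\<in>vertex_indices v n \<sigma>. i < j)"
proof -
  have fin: "finite \<sigma>" by (rule simplex_finite[OF K \<sigma>])
  have swap: "(insert (v i) (\<sigma> - {v j}), \<sigma>) \<in> lex_filtration v n K \<longleftrightarrow> i < j"
    and swap_facet: "facet K (insert (v i) (\<sigma> - {v j})) (insert (v i) \<sigma>)"
    if "j \<in> vertex_indices v n \<sigma>" for j
  proof -
    have j: "j \<in> {1..n}" "v j \<in> \<sigma>" using that by (auto simp: vertex_indices_def)
    have mem: "insert (v i) (\<sigma> - {v j}) \<in> K"
      by (rule simplex_face[OF K i(3)]) auto
    \<comment> \<open>Written this way, \<sigma> and the exchanged facet are one-vertex extensions
      of a common set.\<close>
    have ins: "insert (v j) (\<sigma> - {v j}) = \<sigma>" using j by blast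
    show "(insert (v i) (\<sigma> - {v j}), \<sigma>) \<in> lex_filtration v n K \<longleftrightarrow> i < j"
      using lex_filtration_insert_iff[OF v, of "\<sigma> - {v j}" i j, unfolded ins] fin i j mem \<sigma> by blast
    have "insert (v i) \<sigma> = insert (v j) (insert (v i) (\<sigma> - {v j}))" using ins by blast
    moreover have "v j \<notin> insert (v i) (\<sigma> - {v j})" using i j by auto
    ultimately show "facet K (insert (v i) (\<sigma> - {v j})) (insert (v i) \<sigma>)"
      unfolding facet_iff_insert[OF K v] using j(1) mem i(3) by blast
  qed
  have other: "\<exists>j\<in>vertex_indices v n \<sigma>. \<rho> = insert (v i) (\<sigma> - {v j})"
    if "facet K \<rho> (insert (v i) \<sigma>)" "\<rho> \<noteq> \<sigma>" for \<rho>
  proof -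
    obtain j where j: "j \<in> {1..n}" "v j \<notin> \<rho>" "insert (v i) \<sigma> = insert (v j) \<rho>"
      using \<open>facet K \<rho> (insert (v i) \<sigma>)\<close> unfolding facet_iff_insert[OF K v] by blast
    \<comment> \<open>Removing \<open>v i\<close> itself would give back \<sigma>, which is
      excluded.\<close>
    have ne: "v j \<noteq> v i" using j that(2) i(2) by (metis insert_ident)
    have "\<rho> = insert (v i) \<sigma> - {v j}" using j(2,3) by simp
    then have "\<rho> = insert (v i) (\<sigma> - {v j})" using ne by (simp add: insert_Diff_if)
    moreover have "v j \<in> \<sigma>" using j(3) ne by (metis insertI1 insertE)
    ultimately show ?thesis using j(1) by (auto simp: vertex_indices_def)
  qed
  have "facet K \<sigma> (insert (v i) \<sigma>)" unfolding facet_iff_insert[OF K v] using \<sigma> i by blast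
  moreover have "insert (v i) (\<sigma> - {v j}) \<noteq> \<sigma>" for j using i(2) by blast
  ultimately have "youngest_facet K (lex_filtration v n K) \<sigma> (insert (v i) \<sigma>) \<longleftrightarrow>
      (\<forall>j\<in>vertex_indices v n \<sigma>. (insert (v i) (\<sigma> - {v j}), \<sigma>) \<in> lex_filtration v n K)"
    unfolding youngest_facet_def by (auto dest: other intro: swap_facet)
  then show ?thesis by (simp add: swap)
qed

theorem lemma3p8:
  fixes K :: "'a set set" and v :: "nat \<Rightarrow> 'a" and n :: nat
  assumes "simplicial_complex K" and "finite K"
    and "bij_betw v {1..n} (\<Union>K)"
  shows "lex_gradient v n K = apparent_pairs K (lex_filtration v n K)"
proof -
  note K = assms(1) and v = assms(3)
  define L where "L = lower_cofacet_indices v n K"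
  \<comment> \<open>Since \<sigma> has a vertex, being below the \<open>Min\<close> of its indices
    means being below all of them; this also forces \<open>v i \<notin> \<sigma>\<close>.\<close>
  have below: "i \<in> L \<sigma> \<longleftrightarrow> i \<in> {1..n} \<and> v i \<notin> \<sigma> \<and> insert (v i) \<sigma> \<in> K
      \<and> (\<forall>j\<in>vertex_indices v n \<sigma>. i < j)" if "\<sigma> \<in> K" for i \<sigma>
  proof -
    have "vertex_indices v n \<sigma> \<noteq> {}"
    proof -
      obtain x where x: "x \<in> \<sigma>" using simplex_nonempty[OF K \<open>\<sigma> \<in> K\<close>] by blast
      then have "x \<in> v ` {1..n}" using v \<open>\<sigma> \<in> K\<close> unfolding bij_betw_def by blast
      then show ?thesis using x by (auto simp: vertex_indices_def)
    qed
    then show ?thesis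
      by (auto simp: L_def lower_cofacet_indices_def) (auto simp: vertex_indices_def)
  qed
  have finL: "finite (L \<sigma>)" for \<sigma> by (simp add: L_def lower_cofacet_indices_def)
  have grad: "(\<sigma>, \<tau>) \<in> lex_gradient v n K \<longleftrightarrow>
      \<sigma> \<in> K \<and> (\<exists>i\<in>L \<sigma>. (\<forall>j\<in>L \<sigma>. i \<le> j) \<and> \<tau> = insert (v i) \<sigma>)" for \<sigma> \<tau>
  proof -
    \<comment> \<open>The finite set \<open>L \<sigma>\<close> has a least element exactly when it
      is nonempty, and that element is its \<open>Min\<close>.\<close>
    have "(\<exists>i\<in>L \<sigma>. (\<forall>j\<in>L \<sigma>. i \<le> j) \<and> \<tau> = insert (v i) \<sigma>) \<longleftrightarrow>
        L \<sigma> \<noteq> {} \<and> \<tau> = insert (v (Min (L \<sigma>))) \<sigma>"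
      using finL by (metis Min_eqI Min_in Min_le empty_iff)
    then show ?thesis by (auto simp: lex_gradient_def L_def)
  qed
  have appar: "(\<sigma>, \<tau>) \<in> apparent_pairs K (lex_filtration v n K) \<longleftrightarrow>
      \<sigma> \<in> K \<and> (\<exists>i\<in>L \<sigma>. (\<forall>j\<in>{1..n}. v j \<notin> \<sigma> \<and> insert (v j) \<sigma> \<in> K \<longrightarrow> i \<le> j)
        \<and> \<tau> = insert (v i) \<sigma>)" for \<sigma> \<tau>
  proof -
    have "(\<sigma>, \<tau>) \<in> apparent_pairs K (lex_filtration v n K) \<longleftrightarrow>
        \<sigma> \<in> K \<and> (\<exists>i. i \<in> {1..n} \<and> v i \<notin> \<sigma> \<and> insert (v i) \<sigma> \<in> K \<and> \<tau> = insert (v i) \<sigma>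
          \<and> youngest_facet K (lex_filtration v n K) \<sigma> (insert (v i) \<sigma>)
          \<and> oldest_cofacet K (lex_filtration v n K) (insert (v i) \<sigma>) \<sigma>)"
      by (auto simp: apparent_pairs_def youngest_facet_def facet_iff_insert[OF K v])
    also have "\<dots> \<longleftrightarrow> \<sigma> \<in> K \<and> (\<exists>i. i \<in> {1..n} \<and> v i \<notin> \<sigma> \<and> insert (v i) \<sigma> \<in> K
          \<and> \<tau> = insert (v i) \<sigma> \<and> (\<forall>j\<in>vertex_indices v n \<sigma>. i < j)
          \<and> (\<forall>j\<in>{1..n}. v j \<notin> \<sigma> \<and> insert (v j) \<sigma> \<in> K \<longrightarrow> i \<le> j))"
      by (simp add: youngest_facet_insert_iff[OF K v] oldest_cofacet_insert_iff[OF K v] cong: conj_cong)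
    finally show ?thesis using below by auto
  qed
  \<comment> \<open>\<open>grad\<close> and \<open>appar\<close> differ only in the range of the
    minimum: the gradient minimizes over \<open>L \<sigma>\<close>, an apparent pair over all
    cofacets.\<close>
  have "(\<forall>j\<in>L \<sigma>. i \<le> j) \<longleftrightarrow> (\<forall>j\<in>{1..n}. v j \<notin> \<sigma> \<and> insert (v j) \<sigma> \<in> K \<longrightarrow> i \<le> j)"
    if \<sigma>: "\<sigma> \<in> K" and i: "i \<in> L \<sigma>" for \<sigma> i
  proof
    assume min: "\<forall>j\<in>L \<sigma>. i \<le> j"
    show "\<forall>j\<in>{1..n}. v j \<notin> \<sigma> \<and> insert (v j) \<sigma> \<in> K \<longrightarrow> i \<le> j"
    proof (intro ballI impI)
      fix j assume j: "j \<in> {1..n}" "v j \<notin> \<sigma> \<and> insert (v j) \<sigma> \<in> K"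
      show "i \<le> j"
      proof (cases "j \<in> L \<sigma>")
        case True
        then show ?thesis using min by blast
      next
        case False
        \<comment> \<open>A cofacet index outside \<open>L \<sigma>\<close> fails only the lower
          bound, so it is at least some vertex index \<open>k\<close>, while \<open>i\<close> lies
          below every vertex index.\<close>
        then obtain k where "k \<in> vertex_indices v n \<sigma>" "k \<le> j"
          using j below[OF \<sigma>, of j] by (auto simp: not_less)
        moreover have "i < k" using i below[OF \<sigma>] \<open>k \<in> vertex_indices v n \<sigma>\<close> by blast
        ultimately show ?thesis by linarith
      qed
    qed
  qed (simp add: below[OF \<sigma>])
  then have "(\<sigma>, \<tau>) \<in> lex_gradient v n K \<longleftrightarrow> (\<sigma>, \<tau>) \<in> apparent_pairs K (lex_filtration v n K)"
    for \<sigma> \<tau>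
    unfolding grad appar by (intro conj_cong bex_cong refl) simp
  then show ?thesis by auto
qed

end
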